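(* Consider the sparse normal means model: for $n\ge 1$ one observes $X=(X_1,\ldots,X_n)$ with $X_i=\theta_i+\varepsilon_i$, where $\theta=(\theta_1,\ldots,\theta_n)\in\mathbb{R}^n$ and $\varepsilon_1,\ldots,\varepsilon_n$ are i.i.d. $\mathcal{N}(0,1)$; $P_\theta$, $E_\theta$ denote the law of $X$ and expectation under parameter $\theta$. For $0\le s_n\le n$ let $\ell_0[s_n]=\{\theta\in\mathbb{R}^n:\ \#\{i:\theta_i\neq 0\}\le s_n\}$. Let the slab $G$ be the Laplace distribution $\mathrm{Lap}(1)$, with density $\gamma(x)=\frac12 e^{-|x|}$, and for $\alpha\in[0,1]$ let $\Pi_\alpha=\bigotimes_{i=1}^n\big((1-\alpha)\delta_0+\alpha G\big)$ be the spike and slab prior on $\theta$, with posterior $\Pi_\alpha[\cdot\mid X]$. Let $\hat\alpha$ be the empirical Bayes estimate defined as a maximiser over $[\alpha_n,1]$ of the log-marginal likelihood $\ell_n(\alpha)=\sum_{i=1}^n\log\big((1-\alpha)\phi(X_i)+\alpha g(X_i)\big)$, where $\phi$ is the standard normal density, $g=\phi*\gamma$, and $\alpha_n$ is defined by $t(\alpha_n)=\sqrt{2\log n}$, $t(\alpha)$ being the posterior median threshold described in the context. Then there exist $D>0$, $N_0>0$ and $c_0>0$ such that for any $n\ge N_0$ and any $s_n$ with $1\le s_n\le c_0 n$, there exists $\theta_0\in\ell_0[s_n]$ such that \[ E_{\theta_0}\int\|\theta-\theta_0\|^2\,d\Pi_{\hat\alpha}[\theta\mid X]\ \ge\ D\,s_n\,e^{\sqrt{\log(n/s_n)}},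 \] where $\|\cdot\|$ is the Euclidean norm and $\Pi_{\hat\alpha}[\cdot\mid X]$ denotes the posterior $\Pi_\alpha[\cdot\mid X]$ with $\alpha$ replaced by $\hat\alpha$.
   Context: For fixed $\alpha$, the posterior is $\Pi_\alpha[\cdot\mid X]=\bigotimes_{i=1}^n\big((1-a(X_i))\delta_0+a(X_i)G_{X_i}\big)$, where $a(x)=\frac{\alpha g(x)}{(1-\alpha)\phi(x)+\alpha g(x)}$ and $G_{x}$ has Lebesgue density $\gamma_x(u)=\phi(x-u)\gamma(u)/g(x)$. For fixed $\alpha$, the coordinatewise posterior median of $\theta_i$ is a thresholding rule: there exists $t(\alpha)>0$ such that the posterior median of $\theta_i$ is $0$ if and only if $|X_i|\le t(\alpha)$; $t(\cdot)$ is continuous and strictly decreasing, which defines $\alpha_n$ through $t(\alpha_n)=\sqrt{2\log n}$. *)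

theory Defs
  imports "HOL-Probability.Probability"
begin

definition phi :: "real \<Rightarrow> real" where
  "phi x = std_normal_density x"

definition lap_gamma :: "real \<Rightarrow> real" where
  "lap_gamma u = exp (- \<bar>u\<bar>) / 2"

definition gconv :: "real \<Rightarrow> real" where
  "gconv x = (\<integral>u. phi (x - u) * lap_gamma u \<partial>lborel)"

definition post_weight :: "real \<Rightarrow> real \<Rightarrow> real" where
  "post_weight \<alpha> x = \<alpha> * gconv x / ((1 - \<alpha>) * phi x + \<alpha> * gconv x)"

definition slab_post_dens :: "real \<Rightarrow> real \<Rightarrow> real" where
  "slab_post_dens x u = phi (x - u) * lap_gamma u / gconv x"

definition post_int :: "real \<Rightarrow> real \<Rightarrow> (real \<Rightarrow> real) \<Rightarrow> real" where
  "post_int \<alpha> x f = (1 - post_weight \<alpha> x) * f 0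
      + post_weight \<alpha> x * (\<integral>u. f u * slab_post_dens x u \<partial>lborel)"

definition post_mass_le0 :: "real \<Rightarrow> real \<Rightarrow> real" where
  "post_mass_le0 \<alpha> x = (1 - post_weight \<alpha> x)
      + post_weight \<alpha> x * (\<integral>u. indicator {..0} u * slab_post_dens x u \<partial>lborel)"

definition post_mass_ge0 :: "real \<Rightarrow> real \<Rightarrow> real" where
  "post_mass_ge0 \<alpha> x = (1 - post_weight \<alpha> x)
      + post_weight \<alpha> x * (\<integral>u. indicator {0..} u * slab_post_dens x u \<partial>lborel)"

text \<open>The posterior median is 0 (it is unique, the posterior cdf being strictly
  increasing away from its atom at 0).\<close>

definition post_median_zero :: "real \<Rightarrow> real \<Rightarrow> bool" where
  "post_median_zero \<alpha> x \<longleftrightarrow> post_mass_le0 \<alpha> x \<ge> 1/2 \<and> post_mass_ge0 \<alpha> x \<ge> 1/2"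

definition thr :: "real \<Rightarrow> real" where
  "thr \<alpha> = (THE t. t > 0 \<and> (\<forall>x. post_median_zero \<alpha> x \<longleftrightarrow> \<bar>x\<bar> \<le> t))"

definition alpha_n :: "nat \<Rightarrow> real" where
  "alpha_n n = (THE \<alpha>. 0 < \<alpha> \<and> \<alpha> < 1 \<and> thr \<alpha> = sqrt (2 * ln (real n)))"

definition loglik :: "nat \<Rightarrow> (nat \<Rightarrow> real) \<Rightarrow> real \<Rightarrow> real" where
  "loglik n X \<alpha> = (\<Sum>i<n. ln ((1 - \<alpha>) * phi (X i) + \<alpha> * gconv (X i)))"

text \<open>Integral of ||theta - theta0||^2 against the product posterior Pi_alpha[. | X].\<close>

definition post_sq_loss :: "nat \<Rightarrow> real \<Rightarrow> (nat \<Rightarrow> real) \<Rightarrow> (nat \<Rightarrow> real) \<Rightarrow> real" where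
  "post_sq_loss n \<alpha> X \<theta>0 = (\<Sum>i<n. post_int \<alpha> (X i) (\<lambda>u. (u - \<theta>0 i)^2))"

definition P_theta :: "nat \<Rightarrow> (nat \<Rightarrow> real) \<Rightarrow> (nat \<Rightarrow> real) measure" where
  "P_theta n \<theta> = (\<Pi>\<^sub>M i\<in>{..<n}. density lborel (normal_density (\<theta> i) 1))"

definition ell0 :: "nat \<Rightarrow> nat \<Rightarrow> (nat \<Rightarrow> real) set" where
  "ell0 n s = {\<theta>. (\<forall>i\<ge>n. \<theta> i = 0) \<and> card {i. i < n \<and> \<theta> i \<noteq> 0} \<le> s}"

end

theory Submission
  imports Defs "HOL-Real_Asymp.Real_Asymp"
begin

text \<open>
  The loss is already large on the zero coordinates. For every observation the posterior weight of
  the slab is at least a constant times \<open>\<alpha>\<close> and the slab posterior has second moment bounded below,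
  so the loss is at least of order \<open>n \<alpha>\<close>, whatever the data. It remains to see that the Laplace slab
  makes the estimated weight exceed \<open>\<alpha> / 2\<close> with probability bounded below, where
  \<open>\<alpha> = (s / n) exp (sqrt (ln (n / s)))\<close>.

  The log-likelihood is concave in the weight, so an estimate below \<open>\<alpha> / 2\<close> forces the likelihood ratio
  of \<open>\<alpha> / 2\<close> against \<open>\<alpha>\<close> to be at least 1, and by Markov's inequality it suffices that this ratio has
  expectation below 1. Under \<open>\<theta>\<^sub>0\<close> with \<open>s\<close> huge coordinates the expectation factorises: a huge
  coordinate contributes a factor close to 1/2, and a zero coordinate contributes
  \<open>1 + (\<alpha>\<^sup>2 / 2) \<integral> (g - \<phi>)\<^sup>2 / ((1 - \<alpha>) \<phi> + \<alpha> g)\<close>. Bounding the integrand by \<open>2 g\<^sup>2 / \<phi>\<close> up to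
  \<open>\<bar>x\<bar> = (6/5) sqrt (ln (n / s))\<close> and by \<open>g / \<alpha>\<close> beyond, with \<open>g x \<le> C exp (- \<bar>x\<bar>)\<close>, makes the
  excess over 1 negligible compared with \<open>s / n\<close>.
\<close>

section \<open>Two facts on Lebesgue integrals\<close>

text \<open>A zero integral would make \<open>f\<close> vanish almost everywhere, yet the interval
  from 0 to 1 has positive measure. Positivity is asked only for \<open>u > 0\<close> because the
  integrands met later are cut off on one side or vanish at 0.\<close>

lemma integral_pos_if_pos_on_positives:
  fixes f :: "real \<Rightarrow> real"
  assumes "integrable lborel f" and "\<And>u. 0 \<le> f u" and pos: "\<And>u. u > 0 \<Longrightarrow> 0 < f u"
  shows "0 < integral\<^sup>L lborel f"
proof (rule ccontr)
  assume "\<not> ?thesis"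
  moreover have "0 \<le> integral\<^sup>L lborel f" using assms by simp
  ultimately have "integral\<^sup>L lborel f = 0" by simp
  then have "AE u in lborel. f u = 0"
    using integral_nonneg_eq_0_iff_AE[OF assms(1)] assms(2) by simp
  then have "AE u in lborel. u \<notin> {0<..<1::real}"
    by eventually_elim (use pos in force)
  then have "emeasure lborel {0<..<1::real} = 0"
    by (subst (asm) AE_iff_measurable[where N = "{0<..<1}"]) auto
  then show False by simp
qed

text \<open>The function is the sum of an exponential density and its mirror image, divided by
  \<open>l\<close>. Both count the point 0, so the identity holds only almost everywhere.\<close>

lemma has_bochner_integral_exp_abs:
  fixes l :: real
  assumes l: "0 < l"
  shows "has_bochner_integral lborel (\<lambda>x. exp (- l * \<bar>x\<bar>)) (2 / l)"
proof -
  have e: "has_bochner_integral lborel (exponential_density l) 1"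
  proof (rule has_bochner_integral_nn_integral)
    have "emeasure (density lborel (exponential_density l)) UNIV = 1"
      using prob_space.emeasure_space_1[OF prob_space_exponential_density[OF l]] by simp
    then show "(\<integral>\<^sup>+ x. ennreal (exponential_density l x) \<partial>lborel) = ennreal 1"
      by (simp add: emeasure_density)
  qed (use l in \<open>auto simp: exponential_density_nonneg\<close>)
  have "has_bochner_integral lborel (\<lambda>x. exponential_density l (0 + (-1) * x)) (1 /\<^sub>R \<bar>-1\<bar>)"
    using e by (subst lborel_has_bochner_integral_real_affine_iff[symmetric]) auto
  then have e': "has_bochner_integral lborel (\<lambda>x. exponential_density l (- x)) 1"
    by simp
  have "has_bochner_integral lborel
      (\<lambda>x. (exponential_density l x + exponential_density l (- x)) / l) ((1 + 1) / l)"
    by (intro has_bochner_integral_divide_zero has_bochner_integral_add e e')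
  moreover have "AE x in lborel. (exponential_density l x + exponential_density l (- x)) / l
      = exp (- l * \<bar>x\<bar>)"
    using AE_lborel_singleton[of "0::real"]
    by eventually_elim (use l in \<open>auto simp: exponential_density_def abs_if field_simps\<close>)
  ultimately show ?thesis
    by (subst (asm) has_bochner_integral_cong_AE) auto
qed

section \<open>Slab-to-spike likelihood ratio\<close>

text \<open>Since \<open>phi (x - u) = phi x * exp (x * u - u\<^sup>2 / 2)\<close>, \<open>lratio\<close> is the likelihood ratio
  \<open>g / \<phi>\<close> of slab to spike; \<open>lratio_pos\<close> is the contribution of \<open>u \<ge> 0\<close>.\<close>

definition tilt :: "real \<Rightarrow> real" where
  "tilt u = exp (- u\<^sup>2 / 2 - \<bar>u\<bar>) / 2"

definition lratio :: "real \<Rightarrow> real" where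
  "lratio x = (\<integral>u. exp (x * u) * tilt u \<partial>lborel)"

definition lratio_pos :: "real \<Rightarrow> real" where
  "lratio_pos x = (\<integral>u. indicator {0..} u * (exp (x * u) * tilt u) \<partial>lborel)"

lemma measurable_tilt [measurable]: "tilt \<in> borel_measurable borel"
  unfolding tilt_def[abs_def] by measurable

lemma tilt_pos: "0 < tilt u" and tilt_minus [simp]: "tilt (- u) = tilt u"
  by (auto simp: tilt_def)

lemma phi_pos: "0 < phi x"
  by (simp add: phi_def normal_density_pos)

lemma measurable_phi [measurable]: "phi \<in> borel_measurable borel"
  unfolding phi_def[abs_def] by measurable

lemma phi_diff_lap_gamma: "phi (x - u) * lap_gamma u = phi x * (exp (x * u) * tilt u)"
proof -
  have "exp (- (x - u)\<^sup>2 / 2) * exp (- \<bar>u\<bar>)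
      = exp (- x\<^sup>2 / 2) * (exp (x * u) * exp (- u\<^sup>2 / 2 - \<bar>u\<bar>))"
    by (simp add: mult_exp_exp power2_eq_square field_simps)
  then show ?thesis
    by (simp add: phi_def lap_gamma_def tilt_def normal_density_def)
qed

text \<open>Growth of order \<open>exp \<bar>u\<bar>\<close> is exactly what the Laplace factor
  absorbs, leaving a multiple of a normal density centred at \<open>x\<close> as dominating
  function.\<close>

lemma integrable_tilt:
  fixes f :: "real \<Rightarrow> real"
  assumes [measurable]: "f \<in> borel_measurable borel" and bd: "\<And>u. \<bar>f u\<bar> \<le> B * exp \<bar>u\<bar>"
  shows "integrable lborel (\<lambda>u. f u * (exp (x * u) * tilt u))"
proof (rule Bochner_Integration.integrable_bound)
  show "integrable lborel (\<lambda>u. (B / (2 * phi x)) * normal_density x 1 u)" by simp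
  show "AE u in lborel. norm (f u * (exp (x * u) * tilt u)) \<le> norm ((B / (2 * phi x)) * normal_density x 1 u)"
  proof (rule AE_I2)
    fix u
    have B: "0 \<le> B" using bd[of 0] by (simp add: order_trans[OF abs_ge_zero])
    have n: "normal_density x 1 u = phi (x - u)"
      by (simp add: phi_def normal_density_def power2_commute)
    have "\<bar>f u\<bar> * (phi (x - u) * lap_gamma u) \<le> (B * exp \<bar>u\<bar>) * (phi (x - u) * lap_gamma u)"
      by (intro mult_right_mono bd) (auto simp: lap_gamma_def less_imp_le[OF phi_pos])
    also have "\<dots> = B / 2 * phi (x - u)"
      by (simp add: lap_gamma_def exp_minus)
    finally have "\<bar>f u\<bar> * (exp (x * u) * tilt u) \<le> B / (2 * phi x) * phi (x - u)"
      unfolding phi_diff_lap_gamma using phi_pos[of x] by (simp add: field_simps)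
    moreover have "0 \<le> B / (2 * phi x) * phi (x - u)" using B phi_pos by (simp add: less_imp_le)
    ultimately show "norm (f u * (exp (x * u) * tilt u)) \<le> norm ((B / (2 * phi x)) * normal_density x 1 u)"
      unfolding n real_norm_def
      by (subst (2) abs_of_nonneg) (auto simp: abs_mult tilt_pos less_imp_le)
  qed
qed measurable

lemma square_le_exp_abs: "(u::real)\<^sup>2 \<le> 2 * exp \<bar>u\<bar>"
  using exp_lower_Taylor_quadratic[of "\<bar>u\<bar>"] by (simp add: power2_eq_square)

lemma integrable_tilt_1: "integrable lborel (\<lambda>u. exp (x * u) * tilt u)"
  using integrable_tilt[of "\<lambda>_. 1" 1 x] by simp

lemma integrable_tilt_indicator:
  "A \<in> sets borel \<Longrightarrow> integrable lborel (\<lambda>u. indicator A u * (exp (x * u) * tilt u))"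
  by (rule integrable_tilt[where B = 1]) (auto simp: indicator_def)

lemma integrable_tilt_square: "integrable lborel (\<lambda>u. u\<^sup>2 * (exp (x * u) * tilt u))"
  by (rule integrable_tilt[where B = 2]) (auto simp: square_le_exp_abs)

lemma gconv_eq: "gconv x = phi x * lratio x"
  by (simp add: gconv_def phi_diff_lap_gamma lratio_def)

lemma lratio_greater_0: "0 < lratio x"
  unfolding lratio_def
  by (rule integral_pos_if_pos_on_positives) (auto simp: integrable_tilt_1 tilt_pos less_imp_le)

lemma integral_reflect: "(\<integral>u. f (- u) \<partial>lborel) = (\<integral>u. f u \<partial>lborel)" for f :: "real \<Rightarrow> real"
  using lborel_integral_real_affine[of "-1" f 0] by simp

lemma lratio_neg_part:
  "(\<integral>u. indicator {..0} u * (exp (x * u) * tilt u) \<partial>lborel) = lratio_pos (- x)"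
  unfolding lratio_pos_def
  by (subst integral_reflect[symmetric]) (auto intro!: Bochner_Integration.integral_cong split: split_indicator)

lemma lratio_split: "lratio x = lratio_pos x + lratio_pos (- x)"
proof -
  have "lratio x = (\<integral>u. indicator {0..} u * (exp (x * u) * tilt u)
      + indicator {..0} u * (exp (x * u) * tilt u) \<partial>lborel)"
    unfolding lratio_def
  proof (rule integral_cong_AE)
    show "AE u in lborel. exp (x * u) * tilt u = indicator {0..} u * (exp (x * u) * tilt u)
      + indicator {..0} u * (exp (x * u) * tilt u)"
      using AE_lborel_singleton[of "0::real"]
      by eventually_elim (auto split: split_indicator)
  qed measurable
  also have "\<dots> = lratio_pos x + lratio_pos (- x)"
    by (subst Bochner_Integration.integral_add)
      (auto simp: integrable_tilt_indicator lratio_neg_part lratio_pos_def[symmetric])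
  finally show ?thesis .
qed

text \<open>A mixture of the convex functions \<open>exp (x * u)\<close> with nonnegative weights.
  Convexity on the whole line yields continuity without a dominated convergence argument, and hence
  measurability of \<open>lratio\<close>.\<close>

lemma convex_on_lratio_pos: "convex_on UNIV lratio_pos"
proof (rule convex_onI)
  fix t x y :: real
  assume t: "0 < t" "t < 1"
  have "lratio_pos ((1 - t) * x + t * y)
      \<le> (\<integral>u. (1 - t) * (indicator {0..} u * (exp (x * u) * tilt u))
           + t * (indicator {0..} u * (exp (y * u) * tilt u)) \<partial>lborel)"
    unfolding lratio_pos_def
  proof (rule integral_mono)
    fix u
    have "exp ((1 - t) *\<^sub>R (x * u) + t *\<^sub>R (y * u)) \<le> (1 - t) * exp (x * u) + t * exp (y * u)"
      using t by (intro convex_onD[OF exp_convex]) auto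
    then have "exp (((1 - t) * x + t * y) * u) * tilt u
        \<le> ((1 - t) * exp (x * u) + t * exp (y * u)) * tilt u"
      by (intro mult_right_mono) (auto simp: algebra_simps less_imp_le tilt_pos)
    then show "indicator {0..} u * (exp (((1 - t) * x + t * y) * u) * tilt u)
      \<le> (1 - t) * (indicator {0..} u * (exp (x * u) * tilt u))
           + t * (indicator {0..} u * (exp (y * u) * tilt u))"
      by (auto simp: algebra_simps split: split_indicator)
  qed (intro Bochner_Integration.integrable_add integrable_mult_right integrable_tilt_indicator; simp)+
  also have "\<dots> = (1 - t) * lratio_pos x + t * lratio_pos y"
    unfolding lratio_pos_def
    by (subst Bochner_Integration.integral_add) (auto simp: integrable_tilt_indicator)
  finally show "lratio_pos ((1 - t) *\<^sub>R x + t *\<^sub>R y) \<le> (1 - t) * lratio_pos x + t * lratio_pos y"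
    by simp
qed auto

lemma continuous_on_lratio_pos: "continuous_on UNIV lratio_pos"
  by (intro convex_on_continuous convex_on_lratio_pos) auto

lemma continuous_on_lratio: "continuous_on UNIV lratio"
  unfolding lratio_split[abs_def]
  by (intro continuous_intros continuous_on_compose2[OF continuous_on_lratio_pos]) auto

lemma measurable_lratio [measurable]: "lratio \<in> borel_measurable borel"
  by (rule borel_measurable_continuous_onI[OF continuous_on_lratio])

lemma lratio_pos_nonneg: "0 \<le> lratio_pos x"
  unfolding lratio_pos_def by (intro integral_nonneg_AE AE_I2) (auto simp: tilt_pos less_imp_le)

section \<open>Posterior median threshold and positivity of the lower end of the weight
  range\<close>

text \<open>The posterior median vanishes at \<open>x\<close> iff \<open>\<alpha> * \<bar>med_fn x\<bar> \<le> 1 - \<alpha>\<close>, whence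
  \<open>t(\<alpha>) = med_fn\<^sup>-\<^sup>1 (1 / \<alpha> - 1)\<close>.\<close>

definition med_fn :: "real \<Rightarrow> real" where
  "med_fn x = lratio_pos x - lratio_pos (- x)"

lemma med_fn_minus: "med_fn (- x) = - med_fn x"
  by (simp add: med_fn_def)

text \<open>\<open>med_fn x\<close> integrates \<open>2 * sinh (x * u) * tilt u\<close> over
  \<open>u \<ge> 0\<close>, and the integrand is strictly increasing in \<open>x\<close> for every
  \<open>u > 0\<close>.\<close>

lemma med_fn_strict_mono: "strict_mono med_fn"
proof
  fix x y :: real assume xy: "x < y"
  let ?f = "\<lambda>u. (indicator {0..} u * (exp (y * u) * tilt u) - indicator {0..} u * (exp (- y * u) * tilt u))
    - (indicator {0..} u * (exp (x * u) * tilt u) - indicator {0..} u * (exp (- x * u) * tilt u))"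
  have f: "?f u = indicator {0..} u * ((exp (y * u) - exp (- y * u) - exp (x * u) + exp (- x * u)) * tilt u)" for u
    by (simp add: algebra_simps)
  have "0 < integral\<^sup>L lborel ?f"
  proof (rule integral_pos_if_pos_on_positives)
    show "0 \<le> ?f u" for u
    proof (cases "0 \<le> u")
      case True
      then have "x * u \<le> y * u" using xy by (simp add: mult_right_mono)
      then have "exp (x * u) \<le> exp (y * u)" "exp (- y * u) \<le> exp (- x * u)" by auto
      then have "0 \<le> exp (y * u) - exp (- y * u) - exp (x * u) + exp (- x * u)" by linarith
      then show ?thesis unfolding f using True tilt_pos[of u] by (simp add: zero_le_mult_iff)
    qed auto
    show "0 < ?f u" if u: "u > 0" for u
    proof -
      have "x * u < y * u" using xy u by simp
      then have "exp (x * u) < exp (y * u)" "exp (- y * u) < exp (- x * u)" by auto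
      then have "0 < exp (y * u) - exp (- y * u) - exp (x * u) + exp (- x * u)" by linarith
      then show ?thesis unfolding f using u tilt_pos[of u] by (simp add: zero_less_mult_iff)
    qed
  qed (intro Bochner_Integration.integrable_diff integrable_tilt_indicator; simp)
  also have "integral\<^sup>L lborel ?f = med_fn y - med_fn x"
    unfolding med_fn_def lratio_pos_def
    by (intro has_bochner_integral_integral_eq has_bochner_integral_diff
        has_bochner_integral_integrable integrable_tilt_indicator) simp_all
  finally show "med_fn x < med_fn y" by simp
qed

lemma le_exp: "x \<le> exp x" for x :: real
  using exp_ge_add_one_self[of x] by linarith

text \<open>Integrate \<open>x * u \<le> exp (x * u)\<close> over the half-line; the slope is the
  half-line first moment of \<open>tilt\<close>. This gives divergence of \<open>lratio\<close> and
  unboundedness of \<open>med_fn\<close>.\<close>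

lemma lratio_pos_linear_lower_bound: "\<exists>m>0. \<forall>x. m * x \<le> lratio_pos x"
proof -
  \<comment> \<open>The factor \<open>exp (0 * u)\<close> equals 1; it only puts the integrand in
    the shape of \<open>integrable_tilt\<close>.\<close>
  let ?f = "\<lambda>u::real. (indicator {0..} u * u) * (exp (0 * u) * tilt u)"
  have i: "integrable lborel ?f"
  proof (rule integrable_tilt[where B = 1])
    show "\<bar>indicator {0..} u * u\<bar> \<le> 1 * exp \<bar>u\<bar>" for u :: real
      using le_exp[of u] by (auto split: split_indicator)
  qed simp
  have "0 < integral\<^sup>L lborel ?f"
    by (rule integral_pos_if_pos_on_positives[OF i]) (auto simp: tilt_pos less_imp_le split: split_indicator)
  moreover have "integral\<^sup>L lborel ?f * x \<le> lratio_pos x" for x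
  proof -
    have "integral\<^sup>L lborel ?f * x = (\<integral>u. ?f u * x \<partial>lborel)" by simp
    also have "\<dots> \<le> lratio_pos x"
      unfolding lratio_pos_def
    proof (rule integral_mono)
      show "integrable lborel (\<lambda>u. ?f u * x)" by (intro integrable_mult_left i)
      fix u :: real
      have "x * u * tilt u \<le> exp (x * u) * tilt u"
        by (intro mult_right_mono le_exp less_imp_le[OF tilt_pos])
      then show "?f u * x \<le> indicator {0..} u * (exp (x * u) * tilt u)"
        by (auto split: split_indicator simp: mult_ac)
    qed (auto intro!: integrable_tilt_indicator)
    finally show ?thesis .
  qed
  ultimately show ?thesis by blast
qed

lemma filterlim_lratio_at_top: "filterlim lratio at_top at_top"
proof -
  obtain m where m: "m > 0" "\<And>x. m * x \<le> lratio_pos x" using lratio_pos_linear_lower_bound by auto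
  have "filterlim (\<lambda>x. m * x) at_top at_top" using m(1) by real_asymp
  moreover have "m * x \<le> lratio x" for x
    using m(2)[of x] lratio_pos_nonneg[of "-x"] by (simp add: lratio_split)
  ultimately show ?thesis using filterlim_at_top_mono[of "\<lambda>x. m * x" at_top lratio] by simp
qed

lemma med_fn_attains:
  assumes c: "c > 0"
  shows "\<exists>t>0. med_fn t = c"
proof -
  obtain m where m: "m > 0" "\<And>x. m * x \<le> lratio_pos x" using lratio_pos_linear_lower_bound by auto
  \<comment> \<open>At \<open>K\<close> the linear bound gives
    \<open>lratio_pos K \<ge> c + lratio_pos 0\<close>, while
    \<open>lratio_pos (- K) \<le> lratio_pos 0\<close>, so \<open>med_fn\<close> has reached
    \<open>c\<close> and the intermediate value theorem applies.\<close>
  define K where "K = (c + lratio_pos 0) / m"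
  have K: "K > 0" using c m lratio_pos_nonneg[of 0] by (simp add: K_def field_simps add_pos_nonneg)
  have "lratio_pos (- K) \<le> lratio_pos 0"
    unfolding lratio_pos_def
    by (intro integral_mono integrable_tilt_indicator)
      (use K in \<open>auto split: split_indicator simp: tilt_pos\<close>)
  then have "c \<le> med_fn K" using m(2)[of K] m(1) by (simp add: med_fn_def K_def)
  moreover have "med_fn 0 = 0" by (simp add: med_fn_def)
  moreover have "continuous_on {0..K} med_fn"
    unfolding med_fn_def
    by (intro continuous_intros continuous_on_compose2[OF continuous_on_lratio_pos]) auto
  ultimately obtain t where "0 \<le> t" "t \<le> K" "med_fn t = c"
    using IVT'[of med_fn 0 c K] c K by auto
  moreover from this have "t \<noteq> 0" using \<open>med_fn 0 = 0\<close> c by auto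
  ultimately show ?thesis by (intro exI[of _ t]) auto
qed

lemma mix_pos: "0 < \<alpha> \<Longrightarrow> \<alpha> \<le> 1 \<Longrightarrow> 0 < (1 - \<alpha>) + \<alpha> * lratio x"
  by (simp add: add_nonneg_pos lratio_greater_0)

lemma post_weight_eq: "post_weight \<alpha> x = \<alpha> * lratio x / ((1 - \<alpha>) + \<alpha> * lratio x)"
proof -
  have "post_weight \<alpha> x = phi x * (\<alpha> * lratio x) / (phi x * ((1 - \<alpha>) + \<alpha> * lratio x))"
    by (simp add: post_weight_def gconv_eq algebra_simps)
  then show ?thesis using phi_pos[of x] by simp
qed

lemma slab_post_dens_eq: "slab_post_dens x u = exp (x * u) * tilt u / lratio x"
  using phi_pos[of x] by (simp add: slab_post_dens_def phi_diff_lap_gamma gconv_eq)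

text \<open>Clearing the positive normaliser and splitting \<open>lratio x\<close> into its two
  half-line parts turns each mass condition into a one-sided bound on
  \<open>\<alpha> * med_fn x\<close>; together they bound the absolute value.\<close>

lemma post_median_zero_iff:
  assumes a: "0 < \<alpha>" "\<alpha> \<le> 1"
  shows "post_median_zero \<alpha> x \<longleftrightarrow> \<alpha> * \<bar>med_fn x\<bar> \<le> 1 - \<alpha>"
proof -
  define b p m where "b = lratio x" and "p = lratio_pos x" and "m = lratio_pos (- x)"
  have b: "b = p + m" by (simp add: b_def p_def m_def lratio_split)
  have b0: "b > 0" by (simp add: b_def lratio_greater_0)
  have d: "(1 - \<alpha>) + \<alpha> * b > 0" unfolding b_def by (rule mix_pos[OF a])
  have w: "post_weight \<alpha> x = \<alpha> * b / ((1 - \<alpha>) + \<alpha> * b)" by (simp add: post_weight_eq b_def)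
  have "(\<integral>u. indicator {..0} u * slab_post_dens x u \<partial>lborel) = m / b"
    by (simp add: slab_post_dens_eq lratio_neg_part m_def b_def)
  then have "post_mass_le0 \<alpha> x = ((1 - \<alpha>) + \<alpha> * m) / ((1 - \<alpha>) + \<alpha> * b)"
    unfolding post_mass_le0_def w using b0 d by (simp add: divide_simps) (simp add: algebra_simps)
  then have le: "post_mass_le0 \<alpha> x \<ge> 1/2 \<longleftrightarrow> \<alpha> * (p - m) \<le> 1 - \<alpha>"
    using d by (simp add: pos_le_divide_eq b) (auto simp: algebra_simps)
  have "(\<integral>u. indicator {0..} u * slab_post_dens x u \<partial>lborel) = p / b"
    by (simp add: slab_post_dens_eq lratio_pos_def p_def b_def)
  then have "post_mass_ge0 \<alpha> x = ((1 - \<alpha>) + \<alpha> * p) / ((1 - \<alpha>) + \<alpha> * b)"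
    unfolding post_mass_ge0_def w using b0 d by (simp add: divide_simps) (simp add: algebra_simps)
  then have ge: "post_mass_ge0 \<alpha> x \<ge> 1/2 \<longleftrightarrow> \<alpha> * (m - p) \<le> 1 - \<alpha>"
    using d by (simp add: pos_le_divide_eq b) (auto simp: algebra_simps)
  have "med_fn x = p - m" by (simp add: med_fn_def p_def m_def)
  then show ?thesis
    unfolding post_median_zero_def le ge using a abs_mult[of \<alpha> "p - m"]
    by (auto simp: abs_le_iff algebra_simps)
qed

text \<open>The choice of \<alpha> means \<open>1 - \<alpha> = \<alpha> * med_fn t\<close>. Since
  \<open>med_fn\<close> is odd and strictly increasing, the median condition becomes
  \<open>\<bar>x\<bar> \<le> t\<close>. Testing at \<open>t\<close> and at a rival \<open>t'\<close>
  settles uniqueness of the described value.\<close>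

lemma thr_eqI:
  assumes t: "t > 0" and \<alpha>: "\<alpha> = 1 / (1 + med_fn t)"
  shows "thr \<alpha> = t"
proof -
  have h0: "med_fn 0 = 0" by (simp add: med_fn_def)
  have ht: "med_fn t > 0" using strict_monoD[OF med_fn_strict_mono t] h0 by simp
  then have a: "0 < \<alpha>" "\<alpha> \<le> 1" by (auto simp: \<alpha>)
  have ab: "\<bar>med_fn x\<bar> = med_fn \<bar>x\<bar>" for x
    using strict_monoD[OF med_fn_strict_mono, of x 0] strict_monoD[OF med_fn_strict_mono, of 0 x] h0
    by (cases x "0::real" rule: linorder_cases) (auto simp: med_fn_minus)
  have iff: "post_median_zero \<alpha> x \<longleftrightarrow> \<bar>x\<bar> \<le> t" for x
  proof -
    have "1 - \<alpha> = \<alpha> * med_fn t" using ht by (simp add: \<alpha> field_simps)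
    then show ?thesis
      unfolding post_median_zero_iff[OF a] using a strict_mono_less_eq[OF med_fn_strict_mono, of "\<bar>x\<bar>" t]
      by (simp add: ab)
  qed
  show ?thesis
    unfolding thr_def
  proof (rule the_equality)
    show "t > 0 \<and> (\<forall>x. post_median_zero \<alpha> x \<longleftrightarrow> \<bar>x\<bar> \<le> t)" using t iff by auto
    fix t' assume t': "t' > 0 \<and> (\<forall>x. post_median_zero \<alpha> x \<longleftrightarrow> \<bar>x\<bar> \<le> t')"
    then have "\<bar>x\<bar> \<le> t \<longleftrightarrow> \<bar>x\<bar> \<le> t'" for x using iff by auto
    from this[of t] this[of t'] t t' show "t' = t" by auto
  qed
qed

text \<open>The definite description says something only once existence and uniqueness are known.
  For \<open>n \<ge> 2\<close> the prescribed threshold is positive, which gives existence; every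
  weight in the open unit interval is \<open>1 / (1 + med_fn t')\<close> for some
  \<open>t' > 0\<close>, which gives uniqueness.\<close>

lemma alpha_n_pos:
  assumes n: "n \<ge> 2"
  shows "0 < alpha_n n"
proof -
  define t where "t = sqrt (2 * ln (real n))"
  have t: "t > 0" using n by (simp add: t_def)
  have ht: "med_fn t > 0" using strict_monoD[OF med_fn_strict_mono t] by (simp add: med_fn_def)
  let ?P = "\<lambda>\<alpha>. 0 < \<alpha> \<and> \<alpha> < 1 \<and> thr \<alpha> = sqrt (2 * ln (real n))"
  have "?P (1 / (1 + med_fn t))" using ht thr_eqI[OF t refl] by (simp add: t_def)
  moreover have "\<alpha> = 1 / (1 + med_fn t)" if P: "?P \<alpha>" for \<alpha>
  proof -
    have "1 / \<alpha> - 1 > 0" using P by (simp add: field_simps)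
    then obtain t' where t': "t' > 0" "med_fn t' = 1 / \<alpha> - 1" using med_fn_attains by blast
    then have *: "\<alpha> = 1 / (1 + med_fn t')" using P by simp
    from thr_eqI[OF t'(1) *] P have "t' = t" by (simp add: t_def)
    with * show ?thesis by simp
  qed
  ultimately have "?P (alpha_n n)"
    unfolding alpha_n_def by (rule theI)
  then show ?thesis by simp
qed

section \<open>Lower bound on the posterior loss at a given weight, uniform in the data\<close>

text \<open>Averaging the integrand with its reflection replaces \<open>exp\<close> by
  \<open>cosh\<close>, which is monotone in the modulus of \<open>u\<close> and so allows pointwise
  comparison.\<close>

lemma integral_tilt_cosh:
  fixes f :: "real \<Rightarrow> real"
  assumes f: "f \<in> borel_measurable borel" "\<And>u. \<bar>f u\<bar> \<le> B * exp \<bar>u\<bar>" and even: "\<And>u. f (- u) = f u"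
  shows "has_bochner_integral lborel (\<lambda>u. f u * (cosh (x * u) * tilt u))
    (\<integral>u. f u * (exp (x * u) * tilt u) \<partial>lborel)"
proof -
  let ?I = "\<lambda>x. \<integral>u. f u * (exp (x * u) * tilt u) \<partial>lborel"
  have i: "has_bochner_integral lborel (\<lambda>u. f u * (exp (x * u) * tilt u)) (?I x)" for x
    by (intro has_bochner_integral_integrable integrable_tilt[OF f])
  have "?I (- x) = ?I x"
    by (subst integral_reflect[symmetric]) (simp add: even)
  then have "has_bochner_integral lborel
      (\<lambda>u. (f u * (exp (x * u) * tilt u) + f u * (exp (- x * u) * tilt u)) / 2) ((?I x + ?I x) / 2)"
    using i[of x] i[of "- x"] by (intro has_bochner_integral_divide_zero has_bochner_integral_add) auto
  moreover have "(f u * (exp (x * u) * tilt u) + f u * (exp (- x * u) * tilt u)) / 2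
      = f u * (cosh (x * u) * tilt u)" for u
    by (simp add: cosh_field_def field_simps)
  ultimately show ?thesis by simp
qed

lemma lratio_ge_lratio_0: "lratio 0 \<le> lratio x"
proof -
  have c: "has_bochner_integral lborel (\<lambda>u. cosh (x * u) * tilt u) (lratio x)" for x
    using integral_tilt_cosh[of "\<lambda>_. 1" 1 x] by (simp add: lratio_def)
  have "(\<integral>u. cosh (0 * u) * tilt u \<partial>lborel) \<le> (\<integral>u. cosh (x * u) * tilt u \<partial>lborel)"
    by (rule integral_mono) (use c[of 0] c[of x] tilt_pos in \<open>auto simp: has_bochner_integral_iff cosh_real_ge_1\<close>)
  then show ?thesis
    using c[of 0] c[of x] by (simp add: has_bochner_integral_iff)
qed

text \<open>Chebyshev's association inequality: \<open>u\<^sup>2\<close> and \<open>cosh (x * u)\<close> are both increasing in \<open>\<bar>u\<bar>\<close>,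
  so tilting by \<open>x\<close> can only increase the second moment.\<close>

lemma second_moment_lower_bound:
  "\<exists>c>0. \<forall>x. c * lratio x \<le> (\<integral>u. u\<^sup>2 * (exp (x * u) * tilt u) \<partial>lborel)"
proof -
  let ?m = "\<lambda>x. \<integral>u. u\<^sup>2 * (exp (x * u) * tilt u) \<partial>lborel"
  have m: "has_bochner_integral lborel (\<lambda>u. u\<^sup>2 * (cosh (x * u) * tilt u)) (?m x)" for x
    by (rule integral_tilt_cosh[where B = 2]) (auto simp: square_le_exp_abs)
  have l: "has_bochner_integral lborel (\<lambda>u. cosh (x * u) * tilt u) (lratio x)" for x
    using integral_tilt_cosh[of "\<lambda>_. 1" 1 x] by (simp add: lratio_def)
  have m0: "?m 0 > 0"
    by (rule integral_pos_if_pos_on_positives[OF integrable_tilt_square]) (auto simp: tilt_pos less_imp_le)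
  \<comment> \<open>The second moment of the slab posterior at observation 0.\<close>
  define c where "c = ?m 0 / lratio 0"
  have c: "c > 0" using m0 lratio_greater_0[of 0] by (simp add: c_def)
  have cl: "c * lratio 0 = ?m 0" using lratio_greater_0[of 0] by (simp add: c_def)
  have "c * lratio x \<le> ?m x" for x
  proof -
    \<comment> \<open>The value of \<open>cosh (x * u)\<close> at the point where
      \<open>u\<^sup>2 = c\<close>, so that \<open>u\<^sup>2 - c\<close> and
      \<open>cosh (x * u) - k\<close> always have the same sign. After integrating their product
      against \<open>tilt\<close>, the part multiplied by \<open>k\<close> vanishes by the choice of
      \<open>c\<close>.\<close>
    define k where "k = cosh (x * sqrt c)"
    have *: "has_bochner_integral lborel (\<lambda>u. (u\<^sup>2 * (cosh (x * u) * tilt u) - c * (cosh (x * u) * tilt u))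
        - k * (u\<^sup>2 * (cosh (0 * u) * tilt u) - c * (cosh (0 * u) * tilt u)))
        ((?m x - c * lratio x) - k * (?m 0 - c * lratio 0))"
      by (intro has_bochner_integral_diff has_bochner_integral_mult_right m l)
    have "0 \<le> (u\<^sup>2 * (cosh (x * u) * tilt u) - c * (cosh (x * u) * tilt u))
        - k * (u\<^sup>2 * (cosh (0 * u) * tilt u) - c * (cosh (0 * u) * tilt u))" for u
    proof -
      have ab: "cosh (x * u) = cosh (\<bar>x\<bar> * \<bar>u\<bar>)" "k = cosh (\<bar>x\<bar> * sqrt c)"
        using cosh_real_abs[of "x * u"] cosh_real_abs[of "x * sqrt c"] c
        by (simp_all add: k_def abs_mult)
      have "0 \<le> (u\<^sup>2 - c) * (cosh (x * u) - k)"
      proof (cases "sqrt c \<le> \<bar>u\<bar>")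
        case True
        then have "c \<le> u\<^sup>2" using c power_mono[of "sqrt c" "\<bar>u\<bar>" 2] by simp
        moreover have "k \<le> cosh (x * u)"
          unfolding ab using True c by (subst cosh_real_nonneg_le_iff) (auto intro!: mult_left_mono)
        ultimately show ?thesis by simp
      next
        case False
        then have "u\<^sup>2 \<le> c" using c power_mono[of "\<bar>u\<bar>" "sqrt c" 2] by simp
        moreover have "cosh (x * u) \<le> k"
          unfolding ab using False c by (subst cosh_real_nonneg_le_iff) (auto intro!: mult_left_mono)
        ultimately show ?thesis by (simp add: mult_nonpos_nonpos)
      qed
      then have "0 \<le> (u\<^sup>2 - c) * (cosh (x * u) - k) * tilt u" using tilt_pos[of u] by simp
      then show ?thesis by (simp add: algebra_simps)
    qed
    then have "0 \<le> (?m x - c * lratio x) - k * (?m 0 - c * lratio 0)"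
      unfolding has_bochner_integral_integral_eq[OF *, symmetric]
      by (rule Bochner_Integration.integral_nonneg)
    then show ?thesis using cl by simp
  qed
  with c show ?thesis by blast
qed

text \<open>The denominator is a convex combination of 1 and \<open>lratio x\<close>, hence at most
  their maximum, so dividing \<open>lratio x\<close> by it gives at least
  \<open>min 1 (lratio x)\<close>; and \<open>lratio\<close> is smallest at 0.\<close>

lemma post_weight_lower_bound:
  assumes a: "0 < \<alpha>" "\<alpha> \<le> 1"
  shows "\<alpha> * min 1 (lratio 0) \<le> post_weight \<alpha> x"
proof -
  define b m where "b = lratio x" and "m = min 1 (lratio 0)"
  have m: "m \<le> 1" "m \<le> b" using lratio_ge_lratio_0[of x] by (auto simp: m_def b_def)
  have b: "b > 0" by (simp add: b_def lratio_greater_0)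
  have d: "(1 - \<alpha>) + \<alpha> * b > 0" unfolding b_def by (rule mix_pos[OF a])
  have "(1 - \<alpha>) * m + (\<alpha> * b) * m \<le> (1 - \<alpha>) * b + (\<alpha> * b) * 1"
    using a b m by (intro add_mono mult_left_mono) auto
  then have "m * ((1 - \<alpha>) + \<alpha> * b) \<le> b" by (simp add: algebra_simps)
  then have "\<alpha> * (m * ((1 - \<alpha>) + \<alpha> * b)) \<le> \<alpha> * b" using a by simp
  then show ?thesis
    using d by (simp add: post_weight_eq pos_le_divide_eq b_def[symmetric] m_def[symmetric] mult.assoc)
qed

text \<open>Only coordinates from \<open>s\<close> on are kept, where the true mean is 0 and the
  loss is slab weight times slab second moment; the others are nonnegative. The constant does not
  depend on \<open>X\<close>, so a data-dependent weight may be inserted later.\<close>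

lemma post_sq_loss_lower_bound:
  "\<exists>c>0. \<forall>n s \<alpha> X \<theta>. 0 < \<alpha> \<longrightarrow> \<alpha> \<le> 1 \<longrightarrow> (\<forall>i\<ge>s. \<theta> i = 0) \<longrightarrow> s \<le> n \<longrightarrow>
     c * \<alpha> * (real n - real s) \<le> post_sq_loss n \<alpha> X \<theta>"
proof -
  obtain c where c: "c > 0" "\<And>x. c * lratio x \<le> (\<integral>u. u\<^sup>2 * (exp (x * u) * tilt u) \<partial>lborel)"
    using second_moment_lower_bound by auto
  define m where "m = min 1 (lratio 0)"
  have m: "m > 0" by (simp add: m_def lratio_greater_0)
  have "c * m * \<alpha> * (real n - real s) \<le> post_sq_loss n \<alpha> X \<theta>"
    if a: "0 < \<alpha>" "\<alpha> \<le> 1" and \<theta>: "\<forall>i\<ge>s. \<theta> i = 0" and s: "s \<le> n" for n s \<alpha> X \<theta>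
  proof -
    have w: "\<alpha> * m \<le> post_weight \<alpha> x" for x unfolding m_def by (rule post_weight_lower_bound[OF a])
    have w1: "post_weight \<alpha> x \<le> 1" for x
      using mix_pos[OF a, of x] a by (simp add: post_weight_eq)
    have w0: "0 \<le> post_weight \<alpha> x" for x using w[of x] a m by (intro order_trans[OF _ w]) simp
    have nn: "0 \<le> post_int \<alpha> x (\<lambda>u. (u - t)\<^sup>2)" for x t
      unfolding post_int_def slab_post_dens_eq using w1[of x] w0[of x]
      by (intro add_nonneg_nonneg mult_nonneg_nonneg integral_nonneg_AE AE_I2)
        (auto simp: tilt_pos lratio_greater_0 less_imp_le)
    have lb: "c * m * \<alpha> \<le> post_int \<alpha> x (\<lambda>u. (u - 0)\<^sup>2)" for x
    proof -
      have "c \<le> (\<integral>u. u\<^sup>2 * slab_post_dens x u \<partial>lborel)"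
        using c(2)[of x] lratio_greater_0[of x] by (simp add: slab_post_dens_eq pos_le_divide_eq)
      then have "(\<alpha> * m) * c \<le> post_weight \<alpha> x * (\<integral>u. u\<^sup>2 * slab_post_dens x u \<partial>lborel)"
        using w w0 c(1) by (intro mult_mono) auto
      then show ?thesis by (simp add: post_int_def mult_ac)
    qed
    have "c * m * \<alpha> * (real n - real s) = (\<Sum>i\<in>{s..<n}. c * m * \<alpha>)" using s by simp
    also have "\<dots> \<le> (\<Sum>i\<in>{s..<n}. post_int \<alpha> (X i) (\<lambda>u. (u - \<theta> i)\<^sup>2))"
      by (intro sum_mono) (use \<theta> lb in auto)
    also have "\<dots> \<le> post_sq_loss n \<alpha> X \<theta>"
      unfolding post_sq_loss_def by (intro sum_mono2) (auto simp: nn)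
    finally show ?thesis .
  qed
  with c m show ?thesis by (intro exI[of _ "c * m"]) auto
qed

section \<open>From a small maximiser to a large likelihood ratio\<close>

text \<open>Each summand is the logarithm of an affine function of the weight. A concave function is
  at least the smaller endpoint value in between, and here the right endpoint is the
  smaller.\<close>

lemma loglik_concave:
  assumes "0 < \<alpha>\<^sub>0" "\<alpha>\<^sub>0 < \<alpha>\<^sub>1" "\<alpha>\<^sub>1 < \<alpha>\<^sub>2" "\<alpha>\<^sub>2 \<le> 1" and le: "loglik n X \<alpha>\<^sub>2 \<le> loglik n X \<alpha>\<^sub>0"
  shows "loglik n X \<alpha>\<^sub>2 \<le> loglik n X \<alpha>\<^sub>1"
proof -
  define mx where "mx \<alpha> i = (1 - \<alpha>) * phi (X i) + \<alpha> * gconv (X i)" for \<alpha> i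
  have mx_pos: "0 < mx \<alpha> i" if "0 < \<alpha>" "\<alpha> \<le> 1" for \<alpha> i
    unfolding mx_def using that phi_pos lratio_greater_0 by (intro add_nonneg_pos) (auto simp: gconv_eq less_imp_le)
  define t where "t = (\<alpha>\<^sub>1 - \<alpha>\<^sub>0) / (\<alpha>\<^sub>2 - \<alpha>\<^sub>0)"
  have t: "0 \<le> t" "t \<le> 1" using assms by (auto simp: t_def)
  have "t * (\<alpha>\<^sub>2 - \<alpha>\<^sub>0) = \<alpha>\<^sub>1 - \<alpha>\<^sub>0" using assms by (simp add: t_def)
  then have \<alpha>1: "\<alpha>\<^sub>1 = (1 - t) * \<alpha>\<^sub>0 + t * \<alpha>\<^sub>2" by (simp add: algebra_simps)
  have "(1 - t) * ln (mx \<alpha>\<^sub>0 i) + t * ln (mx \<alpha>\<^sub>2 i) \<le> ln (mx \<alpha>\<^sub>1 i)" for i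
  proof -
    have "mx \<alpha>\<^sub>1 i = (1 - t) *\<^sub>R mx \<alpha>\<^sub>0 i + t *\<^sub>R mx \<alpha>\<^sub>2 i"
      by (simp add: mx_def \<alpha>1 algebra_simps)
    then show ?thesis
      using concave_onD[OF ln_concave t, of "mx \<alpha>\<^sub>0 i" "mx \<alpha>\<^sub>2 i"] mx_pos assms by simp
  qed
  then have "(\<Sum>i<n. (1 - t) * ln (mx \<alpha>\<^sub>0 i) + t * ln (mx \<alpha>\<^sub>2 i)) \<le> loglik n X \<alpha>\<^sub>1"
    unfolding loglik_def mx_def[symmetric] by (rule sum_mono)
  then have "(1 - t) * loglik n X \<alpha>\<^sub>0 + t * loglik n X \<alpha>\<^sub>2 \<le> loglik n X \<alpha>\<^sub>1"
    unfolding loglik_def mx_def[symmetric] by (simp add: sum.distrib sum_distrib_left)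
  moreover have "(1 - t) * loglik n X \<alpha>\<^sub>2 \<le> (1 - t) * loglik n X \<alpha>\<^sub>0"
    using t le by (intro mult_left_mono) auto
  ultimately show ?thesis by (simp add: algebra_simps)
qed

text \<open>The ratio of the marginal densities of one observation at \<open>\<alpha> / 2\<close> and at \<open>\<alpha>\<close>.\<close>

definition half_ratio :: "real \<Rightarrow> real \<Rightarrow> real" where
  "half_ratio \<alpha> x = ((1 - \<alpha> / 2) + \<alpha> / 2 * lratio x) / ((1 - \<alpha>) + \<alpha> * lratio x)"

lemma measurable_half_ratio [measurable]: "half_ratio \<alpha> \<in> borel_measurable borel"
  unfolding half_ratio_def[abs_def] by measurable

lemma half_ratio_pos: "0 < \<alpha> \<Longrightarrow> \<alpha> \<le> 1 \<Longrightarrow> 0 < half_ratio \<alpha> x"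
  unfolding half_ratio_def using mix_pos[of \<alpha> x] mix_pos[of "\<alpha> / 2" x] by (intro divide_pos_pos) auto

lemma half_ratio_prod:
  assumes a: "0 < \<alpha>" "\<alpha> \<le> 1"
  shows "(\<Prod>i<n. half_ratio \<alpha> (X i)) = exp (loglik n X (\<alpha> / 2) - loglik n X \<alpha>)"
proof -
  have l: "(1 - \<alpha>) * phi x + \<alpha> * gconv x = phi x * ((1 - \<alpha>) + \<alpha> * lratio x)" for \<alpha> x
    by (simp add: gconv_eq algebra_simps)
  have "half_ratio \<alpha> x = exp (ln ((1 - \<alpha> / 2) * phi x + \<alpha> / 2 * gconv x) - ln ((1 - \<alpha>) * phi x + \<alpha> * gconv x))" for x
  proof -
    have "0 < phi x * ((1 - \<alpha> / 2) + \<alpha> / 2 * lratio x)" "0 < phi x * ((1 - \<alpha>) + \<alpha> * lratio x)"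
      using mix_pos[OF a, of x] mix_pos[of "\<alpha> / 2" x] a phi_pos[of x] by auto
    then show ?thesis
      unfolding l exp_diff using phi_pos[of x] by (subst (1 2) exp_ln) (auto simp: half_ratio_def)
  qed
  then show ?thesis
    unfolding loglik_def sum_subtractf[symmetric] by (subst exp_sum) (auto intro!: prod.cong)
qed

text \<open>The maximiser \<open>h\<close> does at least as well as \<alpha>, and
  \<open>\<alpha> / 2\<close> lies between them, so concavity applies. The event about the estimate
  is thereby covered by one about a product of functions of single observations.\<close>

lemma half_ratio_prod_ge_1:
  assumes a: "0 < \<alpha>" "\<alpha> \<le> 1" and L: "0 < L" "L \<le> h"
    and mx: "\<forall>\<beta>\<in>{L..1}. loglik n X \<beta> \<le> loglik n X h"
    and h: "h < \<alpha> / 2"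
  shows "1 \<le> (\<Prod>i<n. half_ratio \<alpha> (X i))"
proof -
  have "loglik n X \<alpha> \<le> loglik n X h" using a L h by (intro bspec[OF mx]) simp
  then have "loglik n X \<alpha> \<le> loglik n X (\<alpha> / 2)"
    using a L h by (auto intro: loglik_concave[of h, rotated 4])
  then show ?thesis by (simp add: half_ratio_prod[OF a])
qed

section \<open>Tail bound and total mass of the slab marginal\<close>

text \<open>Rate 2 exceeds the Laplace rate 1: in the convolution one unit of decay goes into the
  triangle inequality and the other keeps the bound integrable.\<close>

lemma phi_le_exp: "phi x \<le> exp (2 - 2 * \<bar>x\<bar>)"
proof -
  have "0 \<le> (\<bar>x\<bar> - 2)\<^sup>2" by simp
  then have "- x\<^sup>2 / 2 \<le> 2 - 2 * \<bar>x\<bar>" by (simp add: power2_diff)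
  then have e: "exp (- x\<^sup>2 / 2) \<le> exp (2 - 2 * \<bar>x\<bar>)" by simp
  have "phi x = exp (- x\<^sup>2 / 2) / sqrt (2 * pi)"
    by (simp add: phi_def std_normal_density_def)
  also have "\<dots> \<le> exp (- x\<^sup>2 / 2) / 1"
    using pi_gt3 by (intro divide_left_mono) auto
  also have "\<dots> \<le> exp (2 - 2 * \<bar>x\<bar>)" using e by simp
  finally show ?thesis .
qed

lemma gconv_nonneg: "0 \<le> gconv x"
  using phi_pos[of x] lratio_greater_0[of x] by (simp add: gconv_eq)

lemma measurable_gconv [measurable]: "gconv \<in> borel_measurable borel"
  unfolding gconv_eq[abs_def] by measurable

lemma gconv_le_exp: "gconv x \<le> exp 2 * exp (- \<bar>x\<bar>)"
proof -
  have "has_bochner_integral lborel (\<lambda>u. exp (- 1 * \<bar>x + (- 1) * u\<bar>)) ((2 / 1) /\<^sub>R \<bar>- 1\<bar>)"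
    using has_bochner_integral_exp_abs[of 1]
    by (subst lborel_has_bochner_integral_real_affine_iff[symmetric]) auto
  then have "has_bochner_integral lborel (\<lambda>u. exp (- \<bar>x - u\<bar>)) 2" by simp
  then have i: "has_bochner_integral lborel (\<lambda>u. (exp 2 * exp (- \<bar>x\<bar>) / 2) * exp (- \<bar>x - u\<bar>))
      ((exp 2 * exp (- \<bar>x\<bar>) / 2) * 2)"
    by (rule has_bochner_integral_mult_right)
  have "gconv x \<le> (\<integral>u. (exp 2 * exp (- \<bar>x\<bar>) / 2) * exp (- \<bar>x - u\<bar>) \<partial>lborel)"
    unfolding gconv_def
  proof (rule integral_mono)
    show "integrable lborel (\<lambda>u. phi (x - u) * lap_gamma u)"
      unfolding phi_diff_lap_gamma by (intro integrable_mult_right integrable_tilt_1)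
    show "integrable lborel (\<lambda>u. (exp 2 * exp (- \<bar>x\<bar>) / 2) * exp (- \<bar>x - u\<bar>))"
      using i by (rule integrable.intros)
    fix u
    have "phi (x - u) * lap_gamma u \<le> exp (2 - 2 * \<bar>x - u\<bar>) * (exp (- \<bar>u\<bar>) / 2)"
      unfolding lap_gamma_def by (intro mult_right_mono phi_le_exp) auto
    also have "\<dots> = exp (2 - 2 * \<bar>x - u\<bar> - \<bar>u\<bar>) / 2"
      by (simp add: mult_exp_exp)
    \<comment> \<open>Triangle inequality
      \<open>\<bar>x\<bar> \<le> \<bar>x - u\<bar> + \<bar>u\<bar>\<close>.\<close>
    also have "\<dots> \<le> exp (2 - \<bar>x\<bar> - \<bar>x - u\<bar>) / 2" by simp
    also have "\<dots> = (exp 2 * exp (- \<bar>x\<bar>) / 2) * exp (- \<bar>x - u\<bar>)"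
      by (simp add: mult_exp_exp)
    finally show "phi (x - u) * lap_gamma u \<le> (exp 2 * exp (- \<bar>x\<bar>) / 2) * exp (- \<bar>x - u\<bar>)" .
  qed
  also have "\<dots> = exp 2 * exp (- \<bar>x\<bar>)"
    using has_bochner_integral_integral_eq[OF i] by simp
  finally show ?thesis .
qed

text \<open>By Tonelli's theorem the normal density is integrated first, leaving the mass of the
  Laplace density.\<close>

lemma has_bochner_integral_gconv: "has_bochner_integral lborel gconv 1"
proof (rule has_bochner_integral_nn_integral)
  have [measurable]: "lap_gamma \<in> borel_measurable borel"
    unfolding lap_gamma_def[abs_def] by measurable
  have g: "ennreal (gconv x) = (\<integral>\<^sup>+ u. ennreal (phi (x - u) * lap_gamma u) \<partial>lborel)" for x
    unfolding gconv_def
  proof (rule nn_integral_eq_integral[symmetric])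
    show "integrable lborel (\<lambda>u. phi (x - u) * lap_gamma u)"
      unfolding phi_diff_lap_gamma by (intro integrable_mult_right integrable_tilt_1)
  qed (auto simp: lap_gamma_def phi_pos less_imp_le)
  have one: "(\<integral>\<^sup>+ x. ennreal (phi (x - u) * lap_gamma u) \<partial>lborel) = ennreal (lap_gamma u)" for u
  proof -
    have "(\<integral>\<^sup>+ x. ennreal (phi (x - u) * lap_gamma u) \<partial>lborel)
        = (\<integral>\<^sup>+ x. ennreal (normal_density u 1 x) * ennreal (lap_gamma u) \<partial>lborel)"
      by (intro nn_integral_cong, subst ennreal_mult[symmetric])
        (auto simp: phi_def normal_density_def lap_gamma_def)
    also have "\<dots> = (\<integral>\<^sup>+ x. ennreal (normal_density u 1 x) \<partial>lborel) * ennreal (lap_gamma u)"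
      by (rule nn_integral_multc) simp
    also have "(\<integral>\<^sup>+ x. ennreal (normal_density u 1 x) \<partial>lborel) = 1"
      by (subst nn_integral_eq_integral) auto
    finally show ?thesis by simp
  qed
  have "(\<integral>\<^sup>+ x. ennreal (gconv x) \<partial>lborel)
      = (\<integral>\<^sup>+ x. \<integral>\<^sup>+ u. ennreal (phi (x - u) * lap_gamma u) \<partial>lborel \<partial>lborel)"
    by (simp add: g)
  also have "\<dots> = (\<integral>\<^sup>+ u. \<integral>\<^sup>+ x. ennreal (phi (x - u) * lap_gamma u) \<partial>lborel \<partial>lborel)"
    by (rule lborel_pair.Fubini') measurable
  also have "\<dots> = (\<integral>\<^sup>+ u. ennreal (lap_gamma u) \<partial>lborel)"
    by (simp add: one)
  also have "\<dots> = 1"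
  proof -
    have "has_bochner_integral lborel (\<lambda>u. exp (- 1 * \<bar>u\<bar>) / 2) (2 / 1 / 2 :: real)"
      by (intro has_bochner_integral_divide_zero has_bochner_integral_exp_abs) simp
    then have h: "has_bochner_integral lborel lap_gamma 1"
      by (simp add: lap_gamma_def[abs_def])
    then have "(\<integral>\<^sup>+ u. ennreal (lap_gamma u) \<partial>lborel) = ennreal (integral\<^sup>L lborel lap_gamma)"
      by (intro nn_integral_eq_integral integrable.intros[OF h] AE_I2) (simp add: lap_gamma_def)
    also have "integral\<^sup>L lborel lap_gamma = 1" using h by (rule has_bochner_integral_integral_eq)
    finally show ?thesis by simp
  qed
  finally show "(\<integral>\<^sup>+ x. ennreal (gconv x) \<partial>lborel) = ennreal 1" by simp
qed (auto simp: gconv_nonneg)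

section \<open>Expected likelihood ratio of one zero or one signal coordinate\<close>

lemma half_ratio_eq:
  assumes a: "0 < \<alpha>" "\<alpha> \<le> 1"
  shows "half_ratio \<alpha> x = 1/2 + 1/2 / ((1 - \<alpha>) + \<alpha> * lratio x)"
  using mix_pos[OF a, of x] unfolding half_ratio_def by (simp add: field_simps)

text \<open>An exact second-order expansion in \<alpha>, not an approximation: the remainder,
  weighted by \<open>phi\<close>, is a chi-square type integrand.\<close>

lemma half_ratio_expansion:
  assumes a: "0 < \<alpha>" "\<alpha> \<le> 1"
  shows "half_ratio \<alpha> x = 1 + \<alpha> / 2 * (1 - lratio x)
    + \<alpha>\<^sup>2 / 2 * ((1 - lratio x)\<^sup>2 / ((1 - \<alpha>) + \<alpha> * lratio x))"
proof -
  define b d where "b = lratio x" and "d = (1 - \<alpha>) + \<alpha> * b"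
  have d: "d > 0" unfolding d_def b_def by (rule mix_pos[OF a])
  have "(1 - \<alpha> / 2) + \<alpha> / 2 * b = (1 + \<alpha> / 2 * (1 - b)) * d + \<alpha>\<^sup>2 / 2 * (1 - b)\<^sup>2"
    unfolding d_def by (simp add: algebra_simps power2_eq_square) (simp add: field_simps)
  then show ?thesis
    using d unfolding half_ratio_def b_def[symmetric] d_def[symmetric]
    by (simp add: add_divide_distrib)
qed

text \<open>The three summands come from the \<open>2 * phi\<close> term, the central interval of
  length \<open>2 * z\<close>, and the tails. The last has no factor \<alpha>, since the tail bound
  divides by \<alpha>.\<close>

definition null_err :: "real \<Rightarrow> real \<Rightarrow> real" where
  "null_err \<alpha> z = \<alpha> + \<alpha> * (2 * exp 4 * sqrt (2 * pi) * (1 + exp (z\<^sup>2 / 2 - 2 * z))) * z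
      + 12 * exp 2 * exp (- 11 * z / 12)"

text \<open>The denominator is at least both \<open>1/2\<close> and
  \<open>\<alpha> * lratio x\<close>; the first bound serves inside the interval, the second
  outside.\<close>

lemma chi_square_density_bound:
  assumes a: "0 < \<alpha>" "\<alpha> \<le> 1/2" and z: "0 \<le> z"
  shows "phi x * ((1 - lratio x)\<^sup>2 / ((1 - \<alpha>) + \<alpha> * lratio x)) \<le> 2 * phi x
    + (2 * exp 4 * sqrt (2 * pi) * (1 + exp (z\<^sup>2 / 2 - 2 * z))) * indicator {-z..z} x
    + exp 2 * exp (- 11 * z / 12) / \<alpha> * exp (- (1 / 12) * \<bar>x\<bar>)"
proof -
  define b d where "b = lratio x" and "d = (1 - \<alpha>) + \<alpha> * b"
  define Q where "Q = 2 * exp 4 * sqrt (2 * pi) * (1 + exp (z\<^sup>2 / 2 - 2 * z))"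
  define T where "T = exp 2 * exp (- 11 * z / 12) / \<alpha> * exp (- (1 / 12) * \<bar>x\<bar>)"
  have b: "b > 0" by (simp add: b_def lratio_greater_0)
  have "0 < \<alpha> * b" using a b by simp
  then have d: "1/2 \<le> d" "\<alpha> * b \<le> d" using a unfolding d_def by linarith+
  have p: "phi x > 0" by (rule phi_pos)
  have g: "phi x * b \<le> exp 2 * exp (- \<bar>x\<bar>)" using gconv_le_exp[of x] by (simp add: gconv_eq b_def)
  have Q: "0 \<le> Q" and T: "0 \<le> T" using a by (auto simp: Q_def T_def)
  have "(1 - b)\<^sup>2 / d \<le> (1 + b\<^sup>2) / d"
    using b d by (intro divide_right_mono) (auto simp: power2_eq_square algebra_simps)
  also have "\<dots> = 1 / d + b\<^sup>2 / d" by (simp add: add_divide_distrib)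
  also have "\<dots> \<le> 2 + b\<^sup>2 / d" using d by (simp add: field_simps)
  finally have "phi x * ((1 - b)\<^sup>2 / d) \<le> phi x * (2 + b\<^sup>2 / d)"
    using p by (intro mult_left_mono) auto
  also have "\<dots> = 2 * phi x + phi x * (b\<^sup>2 / d)" by (simp add: algebra_simps)
  finally have 1: "phi x * ((1 - b)\<^sup>2 / d) \<le> 2 * phi x + phi x * (b\<^sup>2 / d)" .
  have 2: "phi x * (b\<^sup>2 / d) \<le> Q" if x: "\<bar>x\<bar> \<le> z"
  proof -
    have "b\<^sup>2 / d \<le> b\<^sup>2 / (1/2)" using d by (intro divide_left_mono) auto
    then have "phi x * (b\<^sup>2 / d) \<le> phi x * (2 * b\<^sup>2)" using p by (intro mult_left_mono) auto
    also have "\<dots> = 2 * (phi x * b)\<^sup>2 / phi x" using p by (simp add: power2_eq_square)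
    also have "\<dots> \<le> 2 * (exp 2 * exp (- \<bar>x\<bar>))\<^sup>2 / phi x"
      using g p b by (intro divide_right_mono mult_left_mono power_mono) auto
    also have "\<dots> = 2 * exp 4 * sqrt (2 * pi) * exp (x\<^sup>2 / 2 - 2 * \<bar>x\<bar>)"
    proof -
      have "phi x = exp (- (x\<^sup>2 / 2)) / sqrt (2 * pi)" by (simp add: phi_def std_normal_density_def)
      then have "1 / phi x = sqrt (2 * pi) * exp (x\<^sup>2 / 2)" by (simp add: exp_minus inverse_eq_divide)
      moreover have "(exp 2 * exp (- \<bar>x\<bar>))\<^sup>2 = exp 4 * exp (- 2 * \<bar>x\<bar>)"
        by (simp add: power2_eq_square mult_exp_exp)
      ultimately have "2 * (exp 2 * exp (- \<bar>x\<bar>))\<^sup>2 / phi x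
          = 2 * (exp 4 * exp (- 2 * \<bar>x\<bar>)) * (sqrt (2 * pi) * exp (x\<^sup>2 / 2))"
        by (metis divide_inverse inverse_eq_divide)
      also have "\<dots> = 2 * exp 4 * sqrt (2 * pi) * (exp (x\<^sup>2 / 2) * exp (- 2 * \<bar>x\<bar>))" by simp
      also have "exp (x\<^sup>2 / 2) * exp (- 2 * \<bar>x\<bar>) = exp (x\<^sup>2 / 2 - 2 * \<bar>x\<bar>)" by (simp add: mult_exp_exp)
      finally show ?thesis .
    qed
    also have "\<dots> \<le> Q"
      unfolding Q_def
    proof (rule mult_left_mono)
      \<comment> \<open>The exponent is nonpositive up to modulus 4; beyond that it increases in the
        modulus, so it is at most its value at \<open>z\<close>.\<close>
      show "exp (x\<^sup>2 / 2 - 2 * \<bar>x\<bar>) \<le> 1 + exp (z\<^sup>2 / 2 - 2 * z)"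
      proof (cases "\<bar>x\<bar> \<le> 4")
        case True
        have "\<bar>x\<bar> * \<bar>x\<bar> \<le> 4 * \<bar>x\<bar>" using True by (intro mult_right_mono) auto
        then have "x\<^sup>2 / 2 - 2 * \<bar>x\<bar> \<le> 0" by (simp add: power2_eq_square)
        then have "exp (x\<^sup>2 / 2 - 2 * \<bar>x\<bar>) \<le> 1" by simp
        then show ?thesis by (smt (verit) exp_gt_zero)
      next
        case False
        have "0 \<le> (z - \<bar>x\<bar>) * (z + \<bar>x\<bar> - 4)" using False x by (intro mult_nonneg_nonneg) auto
        then have "x\<^sup>2 / 2 - 2 * \<bar>x\<bar> \<le> z\<^sup>2 / 2 - 2 * z" by (simp add: power2_eq_square algebra_simps)
        then have "exp (x\<^sup>2 / 2 - 2 * \<bar>x\<bar>) \<le> exp (z\<^sup>2 / 2 - 2 * z)" by simp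
        then show ?thesis by linarith
      qed
    qed simp
    finally show ?thesis .
  qed
  have 3: "phi x * (b\<^sup>2 / d) \<le> T" if x: "z \<le> \<bar>x\<bar>"
  proof -
    have "b\<^sup>2 / d \<le> b\<^sup>2 / (\<alpha> * b)" using a b d by (intro divide_left_mono) auto
    also have "\<dots> = b / \<alpha>" using b by (simp add: power2_eq_square)
    finally have "phi x * (b\<^sup>2 / d) \<le> phi x * b / \<alpha>" using p by (auto dest: mult_left_mono[of _ _ "phi x"])
    also have "\<dots> \<le> exp 2 * exp (- \<bar>x\<bar>) / \<alpha>" using g a by (intro divide_right_mono) auto
    \<comment> \<open>The decay is split as 11/12 plus 1/12: the larger share is frozen at
      \<open>z\<close> for smallness, the rest keeps the tail integrable.\<close>
    also have "\<dots> \<le> exp 2 * (exp (- 11 * z / 12) * exp (- (1 / 12) * \<bar>x\<bar>)) / \<alpha>"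
      using x a by (intro divide_right_mono mult_left_mono) (auto simp: mult_exp_exp)
    finally show ?thesis by (simp add: T_def mult_ac)
  qed
  have "phi x * (b\<^sup>2 / d) \<le> Q * indicator {-z..z} x + T"
    using 2 3 Q T by (cases "\<bar>x\<bar> \<le> z") (auto simp: indicator_def)
  with 1 show ?thesis
    unfolding b_def[symmetric] d_def[symmetric] Q_def[symmetric] T_def[symmetric] by linarith
qed

text \<open>The first-order term of the expansion of \<open>half_ratio\<close> integrates to zero because \<open>g\<close> and \<open>\<phi>\<close>
  both have mass one; the second-order term is split at \<open>\<bar>x\<bar> = z\<close>.\<close>

lemma half_ratio_null:
  assumes a: "0 < \<alpha>" "\<alpha> \<le> 1/2" and z: "0 \<le> z"
  shows "(\<integral>\<^sup>+ x. ennreal (half_ratio \<alpha> x) \<partial>density lborel (normal_density 0 1)) \<le> ennreal (1 + \<alpha> * null_err \<alpha> z)"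
proof -
  define Q where "Q = 2 * exp 4 * sqrt (2 * pi) * (1 + exp (z\<^sup>2 / 2 - 2 * z))"
  define T where "T = exp 2 * exp (- 11 * z / 12) / \<alpha>"
  define F where "F x = (1 + \<alpha> / 2) * phi x - \<alpha> / 2 * gconv x
      + \<alpha>\<^sup>2 / 2 * ((2 * phi x + Q * indicator {-z..z} x) + T * exp (- (1 / 12) * \<bar>x\<bar>))" for x
  have ph: "has_bochner_integral lborel phi 1"
    unfolding phi_def[abs_def] by (simp add: has_bochner_integral_iff)
  have ind: "has_bochner_integral lborel (indicator {-z..z} :: real \<Rightarrow> real) (2 * z)"
    using z by (simp add: has_bochner_integral_iff)
  have F: "has_bochner_integral lborel F ((1 + \<alpha> / 2) * 1 - \<alpha> / 2 * 1
      + \<alpha>\<^sup>2 / 2 * ((2 * 1 + Q * (2 * z)) + T * (2 / (1 / 12))))"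
    unfolding F_def
    by (intro has_bochner_integral_add has_bochner_integral_diff has_bochner_integral_mult_right
        ph ind has_bochner_integral_gconv has_bochner_integral_exp_abs) simp
  have val: "(1 + \<alpha> / 2) * 1 - \<alpha> / 2 * 1 + \<alpha>\<^sup>2 / 2 * ((2 * 1 + Q * (2 * z)) + T * (2 / (1 / 12)))
      = 1 + \<alpha> * null_err \<alpha> z"
    unfolding null_err_def Q_def[symmetric] using a by (simp add: T_def power2_eq_square field_simps)
  have le: "phi x * half_ratio \<alpha> x \<le> F x" for x
  proof -
    have "phi x * half_ratio \<alpha> x = (1 + \<alpha> / 2) * phi x - \<alpha> / 2 * gconv x
        + \<alpha>\<^sup>2 / 2 * (phi x * ((1 - lratio x)\<^sup>2 / ((1 - \<alpha>) + \<alpha> * lratio x)))"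
      using a by (subst half_ratio_expansion) (auto simp: gconv_eq field_simps)
    also have "\<dots> \<le> F x"
      unfolding F_def Q_def T_def
      by (intro add_left_mono mult_left_mono chi_square_density_bound a z) simp
    finally show ?thesis .
  qed
  have "(\<integral>\<^sup>+ x. ennreal (half_ratio \<alpha> x) \<partial>density lborel (normal_density 0 1))
      = (\<integral>\<^sup>+ x. ennreal (phi x) * ennreal (half_ratio \<alpha> x) \<partial>lborel)"
    by (subst nn_integral_density) (auto simp: phi_def)
  also have "\<dots> \<le> (\<integral>\<^sup>+ x. ennreal (F x) \<partial>lborel)"
    using a le by (intro nn_integral_mono)
      (auto simp: ennreal_mult[symmetric] phi_pos half_ratio_pos less_imp_le intro!: ennreal_leI)
  also have "\<dots> = ennreal (integral\<^sup>L lborel F)"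
  proof (rule nn_integral_eq_integral)
    show "integrable lborel F" using F by (rule integrable.intros)
    have "0 \<le> F x" for x
      using a half_ratio_pos[of \<alpha> x] phi_pos[of x] by (intro order_trans[OF _ le]) auto
    then show "AE x in lborel. 0 \<le> F x" by simp
  qed
  also have "integral\<^sup>L lborel F = 1 + \<alpha> * null_err \<alpha> z"
    using has_bochner_integral_integral_eq[OF F] val by simp
  finally show ?thesis .
qed

text \<open>As the mean grows the ratio tends to 1/2 and stays below 3/2, so dominated convergence
  brings the expectation under 3/5. The mean may depend on \<alpha>.\<close>

lemma half_ratio_signal:
  assumes a: "0 < \<alpha>" "\<alpha> \<le> 1/2"
  shows "\<exists>T. (\<integral>\<^sup>+ x. ennreal (half_ratio \<alpha> x) \<partial>density lborel (normal_density T 1)) \<le> ennreal (3/5)"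
proof -
  have le: "half_ratio \<alpha> x \<le> 3/2" for x
  proof -
    have "1/2 \<le> (1 - \<alpha>) + \<alpha> * lratio x" using a lratio_greater_0[of x] by (intro add_increasing2) auto
    then show ?thesis using a by (simp add: half_ratio_eq field_simps)
  qed
  have lim: "filterlim (\<lambda>x. half_ratio \<alpha> x) (nhds (1/2)) at_top"
  proof -
    have "filterlim (\<lambda>b. 1/2 + 1/2 / ((1 - \<alpha>) + \<alpha> * b)) (nhds (1/2)) at_top"
      using a by real_asymp
    from filterlim_compose[OF this filterlim_lratio_at_top] show ?thesis
      using a by (simp add: half_ratio_eq)
  qed
  have "(\<lambda>k. \<integral>x. half_ratio \<alpha> (real k + x) * phi x \<partial>lborel) \<longlonglongrightarrow> (\<integral>x. 1/2 * phi x \<partial>lborel)"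
  proof (rule integral_dominated_convergence[where w = "\<lambda>x. 3/2 * phi x"])
    show "integrable lborel (\<lambda>x. 3/2 * phi x)" unfolding phi_def by simp
    show "AE x in lborel. (\<lambda>k. half_ratio \<alpha> (real k + x) * phi x) \<longlonglongrightarrow> 1/2 * phi x"
    proof (intro AE_I2 tendsto_mult tendsto_const filterlim_compose[OF lim])
      fix x :: real show "filterlim (\<lambda>k. real k + x) at_top sequentially" by real_asymp
    qed
    show "AE x in lborel. norm (half_ratio \<alpha> (real k + x) * phi x) \<le> 3/2 * phi x" for k
      using a le phi_pos half_ratio_pos[of \<alpha>]
      by (intro AE_I2) (auto simp: abs_mult less_imp_le intro!: mult_mono)
  qed measurable
  moreover have "(\<integral>x. 1/2 * phi x \<partial>lborel) = 1/2" unfolding phi_def by simp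
  ultimately have "eventually (\<lambda>k. (\<integral>x. half_ratio \<alpha> (real k + x) * phi x \<partial>lborel) < 3/5) sequentially"
    by (intro order_tendstoD) auto
  then obtain k where k: "(\<integral>x. half_ratio \<alpha> (real k + x) * phi x \<partial>lborel) < 3/5"
    by (auto simp: eventually_sequentially)
  have "(\<integral>\<^sup>+ x. ennreal (half_ratio \<alpha> x) \<partial>density lborel (normal_density (real k) 1))
      = (\<integral>\<^sup>+ x. ennreal (half_ratio \<alpha> x * normal_density (real k) 1 x) \<partial>lborel)"
    using a by (subst nn_integral_density) (auto simp: ennreal_mult half_ratio_pos less_imp_le mult.commute)
  also have "\<dots> = (\<integral>\<^sup>+ x. ennreal (half_ratio \<alpha> (real k + x) * phi x) \<partial>lborel)"
    by (subst nn_integral_real_affine[where c = 1 and t = "real k"])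
      (auto simp: phi_def normal_density_def)
  also have "\<dots> = ennreal (\<integral>x. half_ratio \<alpha> (real k + x) * phi x \<partial>lborel)"
  proof (rule nn_integral_eq_integral)
    show "integrable lborel (\<lambda>x. half_ratio \<alpha> (real k + x) * phi x)"
    proof (rule Bochner_Integration.integrable_bound)
      show "integrable lborel (\<lambda>x. 3/2 * phi x)" unfolding phi_def by simp
      show "AE x in lborel. norm (half_ratio \<alpha> (real k + x) * phi x) \<le> norm (3/2 * phi x)"
        using a le phi_pos half_ratio_pos[of \<alpha>]
        by (intro AE_I2) (auto simp: abs_mult less_imp_le intro!: mult_mono)
    qed measurable
  qed (use a phi_pos half_ratio_pos[of \<alpha>] in \<open>auto simp: less_imp_le\<close>)
  also have "\<dots> \<le> ennreal (3/5)" using k by (intro ennreal_leI) simp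
  finally show ?thesis by blast
qed

section \<open>The whole sample and the choice of constants\<close>

text \<open>By independence the expectation is a product. The zero coordinates together cost at most
  \<open>exp (real s / 10)\<close>, which the factors 3/5 of the \<open>s\<close> signals
  outweigh.\<close>

lemma half_ratio_product_expectation:
  assumes a: "0 < \<alpha>" "\<alpha> \<le> 1/2" and z: "0 \<le> z" and sn: "s \<le> n"
    and T: "(\<integral>\<^sup>+ x. ennreal (half_ratio \<alpha> x) \<partial>density lborel (normal_density T 1)) \<le> ennreal (3/5)"
    and err: "real n * (\<alpha> * null_err \<alpha> z) \<le> real s / 10" and s: "s \<ge> 1"
  shows "(\<integral>\<^sup>+ X. ennreal (\<Prod>i<n. half_ratio \<alpha> (X i)) \<partial>P_theta n (\<lambda>i. if i < s then T else 0)) \<le> ennreal (7/10)"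
proof -
  define \<theta> where "\<theta> i = (if i < s then T else 0)" for i
  define M where "M i = density lborel (normal_density (\<theta> i) 1)" for i
  define \<eta> where "\<eta> = \<alpha> * null_err \<alpha> z"
  have "\<eta> \<ge> 0" using a z by (auto simp: \<eta>_def null_err_def intro!: mult_nonneg_nonneg add_nonneg_nonneg)
  interpret product_sigma_finite M
    unfolding product_sigma_finite_def M_def
    by (intro allI prob_space_imp_sigma_finite prob_space_normal_density) simp
  have "(\<integral>\<^sup>+ X. ennreal (\<Prod>i<n. half_ratio \<alpha> (X i)) \<partial>P_theta n \<theta>)
      = (\<integral>\<^sup>+ X. (\<Prod>i<n. ennreal (half_ratio \<alpha> (X i))) \<partial>Pi\<^sub>M {..<n} M)"
    using a unfolding P_theta_def M_def by (simp add: prod_ennreal half_ratio_pos less_imp_le)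
  also have "\<dots> = (\<Prod>i<n. \<integral>\<^sup>+ x. ennreal (half_ratio \<alpha> x) \<partial>M i)"
    by (rule product_nn_integral_prod) (auto simp: M_def)
  also have "\<dots> \<le> (\<Prod>i<n. ennreal (if i < s then 3/5 else 1 + \<eta>))"
    using T half_ratio_null[OF a z] by (intro prod_mono_ennreal) (auto simp: M_def \<theta>_def \<eta>_def)
  also have "\<dots> = ennreal (\<Prod>i<n. if i < s then 3/5 else 1 + \<eta>)"
    using \<open>\<eta> \<ge> 0\<close> by (intro prod_ennreal) auto
  also have "\<dots> \<le> ennreal (7/10)"
  proof (rule ennreal_leI)
    have "(\<Prod>i<n. if i < s then 3/5 else 1 + \<eta>) = (3/5) ^ s * (1 + \<eta>) ^ (n - s)"
    proof -
      have un: "{..<n} = {..<s} \<union> {s..<n}" using sn by auto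
      have "(\<Prod>i<n. if i < s then 3/5 else 1 + \<eta>)
          = (\<Prod>i\<in>{..<s}. if i < s then 3/5 else 1 + \<eta>) * (\<Prod>i\<in>{s..<n}. if i < s then 3/5 else 1 + \<eta>)"
        unfolding un by (rule prod.union_disjoint) auto
      then show ?thesis by simp
    qed
    also have "(1 + \<eta>) ^ (n - s) \<le> exp (real s / 10)"
    proof -
      have "(1 + \<eta>) ^ (n - s) \<le> exp \<eta> ^ (n - s)"
        using \<open>\<eta> \<ge> 0\<close> exp_ge_add_one_self[of \<eta>] by (intro power_mono) auto
      also have "\<dots> = exp (real (n - s) * \<eta>)" by (rule exp_of_nat_mult[symmetric])
      also have "\<dots> \<le> exp (real n * \<eta>)" using \<open>\<eta> \<ge> 0\<close> by (auto intro!: mult_right_mono)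
      also have "\<dots> \<le> exp (real s / 10)" using err by (simp add: \<eta>_def)
      finally show ?thesis .
    qed
    also have "exp (real s / 10) = exp (1/10) ^ s" by (simp add: exp_of_nat_mult[symmetric])
    also have "(3/5) ^ s * exp (1/10) ^ s = (3/5 * exp (1/10 :: real)) ^ s" by (rule power_mult_distrib[symmetric])
    \<comment> \<open>\<open>exp (1/10) \<le> 1.11\<close>, and 3/5 of that is below 7/10.\<close>
    also have "\<dots> \<le> (7/10) ^ s"
      using exp_bound[of "1/10"] by (intro power_mono) (auto simp: power2_eq_square)
    also have "\<dots> \<le> (7/10) ^ 1" using s by (intro power_decreasing) auto
    finally show "(\<Prod>i<n. if i < s then 3/5 else 1 + \<eta>) \<le> 7/10" by simp
  qed
  finally show ?thesis by (simp add: \<theta>_def[abs_def])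
qed

theorem theorem1:
  shows "\<exists>D>0. \<exists>N0>0. \<exists>c0>(0::real).
    \<forall>n::nat. \<forall>s::nat. real n \<ge> N0 \<longrightarrow> 1 \<le> s \<longrightarrow> real s \<le> c0 * real n \<longrightarrow>
      (\<forall>ahat :: (nat \<Rightarrow> real) \<Rightarrow> real.
         ahat \<in> borel_measurable (\<Pi>\<^sub>M i\<in>{..<n}. lborel) \<longrightarrow>
         (\<forall>X. alpha_n n \<le> ahat X \<and> ahat X \<le> 1 \<and>
              (\<forall>\<alpha>\<in>{alpha_n n..1}. loglik n X \<alpha> \<le> loglik n X (ahat X))) \<longrightarrow>
         (\<exists>\<theta>0 \<in> ell0 n s.
            (\<integral>\<^sup>+ X. ennreal (post_sq_loss n (ahat X) X \<theta>0) \<partial>P_theta n \<theta>0)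
              \<ge> ennreal (D * real s * exp (sqrt (ln (real n / real s))))))"
proof -
  obtain c where c: "c > 0" and loss: "\<And>n s \<alpha> X \<theta>. 0 < \<alpha> \<Longrightarrow> \<alpha> \<le> 1 \<Longrightarrow> \<forall>i\<ge>s. \<theta> i = 0 \<Longrightarrow> s \<le> n \<Longrightarrow>
     c * \<alpha> * (real n - real s) \<le> post_sq_loss n \<alpha> X \<theta>"
    using post_sq_loss_lower_bound by metis
  \<comment> \<open>Here \<open>r\<close> stands for \<open>sqrt (ln (n / s))\<close>, the weight is
    \<open>exp (r - r\<^sup>2)\<close>, and \<open>n\<close> times it is \<open>s * exp r\<close>.
    The cutoff factor 6/5 is below \<open>sqrt 2\<close>, so the central term keeps a negative
    coefficient of \<open>r\<^sup>2\<close>, and above 12/11, so the tail term decays.\<close>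
  have "((\<lambda>r::real. exp r * null_err (exp (r - r\<^sup>2)) (6 * r / 5)) \<longlongrightarrow> 0) at_top"
  proof -
    define A B :: real where "A = 2 * exp 4 * sqrt (2 * pi) * (6/5)" and "B = 12 * exp 2"
    have A: "A > 0" and B: "B > 0" by (auto simp: A_def B_def)
    have "((\<lambda>r::real. exp (2 * r - r\<^sup>2)) \<longlongrightarrow> 0) at_top" by real_asymp
    moreover have "((\<lambda>r::real. A * r * exp (2 * r - r\<^sup>2)) \<longlongrightarrow> 0) at_top" using A by real_asymp
    moreover have "((\<lambda>r::real. A * r * exp (- 2/5 * r - 7/25 * r\<^sup>2)) \<longlongrightarrow> 0) at_top" using A by real_asymp
    moreover have "((\<lambda>r::real. B * exp (- (r / 10))) \<longlongrightarrow> 0) at_top" using B by real_asymp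
    ultimately have "((\<lambda>r::real. exp (2 * r - r\<^sup>2) + A * r * exp (2 * r - r\<^sup>2)
        + A * r * exp (- 2/5 * r - 7/25 * r\<^sup>2) + B * exp (- (r / 10))) \<longlongrightarrow> 0) at_top"
      by (intro tendsto_add_zero)
    moreover have "exp r * null_err (exp (r - r\<^sup>2)) (6 * r / 5) = exp (2 * r - r\<^sup>2) + A * r * exp (2 * r - r\<^sup>2)
        + A * r * exp (- 2/5 * r - 7/25 * r\<^sup>2) + B * exp (- (r / 10))" for r
    proof -
      have e: "exp (2 * r - r\<^sup>2) = exp r * exp (r - r\<^sup>2)"
        "exp (- 2/5 * r - 7/25 * r\<^sup>2) = exp r * exp (r - r\<^sup>2) * exp ((6 * r / 5)\<^sup>2 / 2 - 2 * (6 * r / 5))"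
        "exp (- (r / 10)) = exp r * exp (- 11 * (6 * r / 5) / 12)"
        by (simp_all add: mult_exp_exp power2_eq_square field_simps)
      show ?thesis unfolding null_err_def e A_def B_def by (simp add: algebra_simps)
    qed
    ultimately show ?thesis by simp
  qed
  then have "eventually (\<lambda>r::real. exp r * null_err (exp (r - r\<^sup>2)) (6 * r / 5) < 1/10) at_top"
    by (rule order_tendstoD) simp
  moreover have "eventually (\<lambda>r::real. exp (r - r\<^sup>2) < 1/2) at_top"
    by real_asymp
  ultimately have "eventually (\<lambda>r::real. exp r * null_err (exp (r - r\<^sup>2)) (6 * r / 5) < 1/10
      \<and> exp (r - r\<^sup>2) < 1/2) at_top"
    by (rule eventually_conj)
  then obtain r0 where r0: "\<And>r. r \<ge> r0 \<Longrightarrow> exp r * null_err (exp (r - r\<^sup>2)) (6 * r / 5) < 1/10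
      \<and> exp (r - r\<^sup>2) < 1/2"
    by (auto simp: eventually_at_top_linorder)
  define r1 where "r1 = max 1 r0"
  \<comment> \<open>Sparsity \<open>s \<le> c0 * n\<close> means \<open>r \<ge> r1\<close>, the
    range where the asymptotic estimates hold; \<open>r1 \<ge> 1\<close> makes
    \<open>c0 \<le> 1/2\<close>.\<close>
  define c0 where "c0 = exp (- r1\<^sup>2)"
  \<comment> \<open>Product of \<open>c\<close>, 1/2 from \<open>\<alpha> / 2\<close>, 1/2 from
    \<open>n - s \<ge> n / 2\<close>, and the probability 3/10.\<close>
  define D where "D = c * 3 / 40"
  have "\<exists>\<theta>0 \<in> ell0 n s. ennreal (D * real s * exp (sqrt (ln (real n / real s))))
      \<le> (\<integral>\<^sup>+ X. ennreal (post_sq_loss n (ahat X) X \<theta>0) \<partial>P_theta n \<theta>0)"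
    if n: "real n \<ge> 2" and s: "1 \<le> s" and sn: "real s \<le> c0 * real n"
      and ahat: "ahat \<in> borel_measurable (\<Pi>\<^sub>M i\<in>{..<n}. lborel)"
      and mx: "\<And>X. alpha_n n \<le> ahat X \<and> ahat X \<le> 1 \<and>
              (\<forall>\<alpha>\<in>{alpha_n n..1}. loglik n X \<alpha> \<le> loglik n X (ahat X))"
    for n s :: nat and ahat
  proof -
    define r where "r = sqrt (ln (real n / real s))"
    define \<alpha> where "\<alpha> = exp (r - r\<^sup>2)"
    have r1: "r1 \<ge> 1" "r1 \<ge> r0" by (auto simp: r1_def)
    have npos: "real n > 0" "real s > 0" using n s by auto
    have "exp (r1\<^sup>2) \<le> real n / real s"
      using sn npos by (simp add: c0_def exp_minus field_simps)
    then have "r1\<^sup>2 \<le> ln (real n / real s)"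
      using npos by (subst ln_ge_iff) auto
    then have r: "r \<ge> r1" and r2: "r\<^sup>2 = ln (real n / real s)"
      using r1 by (auto simp: r_def intro: real_le_rsqrt order_trans[OF zero_le_power2])
    have z: "0 \<le> 6 * r / 5" using r r1 by simp
    have a: "0 < \<alpha>" "\<alpha> \<le> 1/2" and er: "exp r * null_err \<alpha> (6 * r / 5) \<le> 1/10"
      using r0[of r] r r1 by (auto simp: \<alpha>_def less_imp_le)
    have na: "real n * \<alpha> = real s * exp r"
      using npos by (simp add: \<alpha>_def exp_diff r2)
    have c0: "c0 \<le> 1/2"
    proof -
      have "1 \<le> r1\<^sup>2" using r1 by simp
      then have "exp 1 \<le> exp (r1\<^sup>2)" by simp
      then have "2 \<le> exp (r1\<^sup>2)" using exp_ge_add_one_self[of 1] by linarith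
      then show ?thesis by (simp add: c0_def exp_minus field_simps)
    qed
    have "c0 * real n \<le> 1/2 * real n" using c0 by (intro mult_right_mono) auto
    with sn have sn2: "real s \<le> real n / 2" by simp
    then have sn': "s \<le> n" by linarith
    obtain T where T: "(\<integral>\<^sup>+ x. ennreal (half_ratio \<alpha> x) \<partial>density lborel (normal_density T 1)) \<le> ennreal (3/5)"
      using half_ratio_signal[OF a] by auto
    define \<theta> where "\<theta> = (\<lambda>i. if i < s then T else 0)"
    have \<theta>: "\<theta> \<in> ell0 n s"
    proof -
      have "card {i. i < n \<and> \<theta> i \<noteq> 0} \<le> card {..<s}" by (intro card_mono) (auto simp: \<theta>_def)
      then show ?thesis using sn' by (auto simp: ell0_def \<theta>_def)
    qed
    have "real n * (\<alpha> * null_err \<alpha> (6 * r / 5)) = real s * (exp r * null_err \<alpha> (6 * r / 5))"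
      using na by (simp add: mult.assoc[symmetric])
    also have "\<dots> \<le> real s * (1/10)" using er by (intro mult_left_mono) auto
    finally have err: "real n * (\<alpha> * null_err \<alpha> (6 * r / 5)) \<le> real s / 10" by simp
    have Z: "(\<integral>\<^sup>+ X. ennreal (\<Prod>i<n. half_ratio \<alpha> (X i)) \<partial>P_theta n \<theta>) \<le> ennreal (7/10)"
      unfolding \<theta>_def by (rule half_ratio_product_expectation[OF a z sn' T err s])
    define P where "P = P_theta n \<theta>"
    interpret P: prob_space P
      unfolding P_def P_theta_def by (intro prob_space_PiM prob_space_normal_density) simp
    have [measurable]: "ahat \<in> borel_measurable P"
      using ahat unfolding P_def P_theta_def
      by (subst measurable_cong_sets[OF sets_PiM_cong refl]) auto
    have an: "0 < alpha_n n" using n by (intro alpha_n_pos) simp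
    define A where "A = {X \<in> space P. ahat X < \<alpha> / 2}"
    have [measurable]: "A \<in> sets P" unfolding A_def by measurable
    \<comment> \<open>Markov's inequality at level 1: the product is at least 1 wherever the
      estimate is below \<open>\<alpha> / 2\<close>.\<close>
    have "emeasure P A = (\<integral>\<^sup>+ X. indicator A X \<partial>P)" by simp
    also have "\<dots> \<le> (\<integral>\<^sup>+ X. ennreal (\<Prod>i<n. half_ratio \<alpha> (X i)) \<partial>P)"
    proof (rule nn_integral_mono)
      fix X
      have "1 \<le> (\<Prod>i<n. half_ratio \<alpha> (X i))" if "ahat X < \<alpha> / 2"
        using a an mx[of X] that by (intro half_ratio_prod_ge_1[of \<alpha> "alpha_n n" "ahat X"]) auto
      then show "indicator A X \<le> ennreal (\<Prod>i<n. half_ratio \<alpha> (X i))"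
        by (auto simp: A_def split: split_indicator simp flip: ennreal_1 intro!: ennreal_leI)
    qed
    also have "\<dots> \<le> ennreal (7/10)" using Z by (simp add: P_def)
    finally have "measure P A \<le> 7/10" by (simp add: P.emeasure_eq_measure)
    then have PA: "measure P (space P - A) \<ge> 3/10" by (simp add: P.prob_compl)
    have "D * real s * exp r = c * (\<alpha> / 2) * (real n / 2) * (3/10)"
      using na by (simp add: D_def mult.commute)
    also have "\<dots> \<le> c * (\<alpha> / 2) * (real n - real s) * measure P (space P - A)"
      using c a sn2 PA by (intro mult_mono) auto
    finally have "ennreal (D * real s * exp r)
        \<le> ennreal (c * (\<alpha> / 2) * (real n - real s) * measure P (space P - A))"
      by (rule ennreal_leI)
    also have "\<dots> = ennreal (c * (\<alpha> / 2) * (real n - real s)) * emeasure P (space P - A)"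
      unfolding P.emeasure_eq_measure using c a sn2 by (intro ennreal_mult) auto
    also have "\<dots> = (\<integral>\<^sup>+ X. ennreal (c * (\<alpha> / 2) * (real n - real s)) * indicator (space P - A) X \<partial>P)"
      by (subst nn_integral_cmult_indicator) auto
    also have "\<dots> \<le> (\<integral>\<^sup>+ X. ennreal (post_sq_loss n (ahat X) X \<theta>) \<partial>P)"
    proof (rule nn_integral_mono)
      fix X assume "X \<in> space P"
      have "c * (\<alpha> / 2) * (real n - real s) \<le> post_sq_loss n (ahat X) X \<theta>" if "\<alpha> / 2 \<le> ahat X"
      proof -
        have "c * (\<alpha> / 2) * (real n - real s) \<le> c * ahat X * (real n - real s)"
          using c that sn2 by (intro mult_right_mono mult_left_mono) auto
        also have "\<dots> \<le> post_sq_loss n (ahat X) X \<theta>"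
          using mx[of X] an sn' by (intro loss) (auto simp: \<theta>_def)
        finally show ?thesis .
      qed
      then show "ennreal (c * (\<alpha> / 2) * (real n - real s)) * indicator (space P - A) X
          \<le> ennreal (post_sq_loss n (ahat X) X \<theta>)"
        using \<open>X \<in> space P\<close> by (auto simp: A_def split: split_indicator intro!: ennreal_leI)
    qed
    finally show ?thesis using \<theta> unfolding P_def r_def by blast
  qed
  moreover have "D > 0" "c0 > 0" using c by (auto simp: D_def c0_def)
  ultimately show ?thesis
    by (intro exI[of _ D] conjI exI[of _ 2] exI[of _ c0]) auto
qed

end
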